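(* Let $X$ be a nonempty set. For each term $t\in \mathrm{T}(X)$ there is an id-reduced polynomial term $t'\in \mathrm{PT}_{\mathrm{id}}(X)$, unique up to $=_{\mathrm{AC}_+}$, which is in normal form with respect to $\Rightarrow_{\mathcal R_{\mathrm{id}}/\mathrm{AC}_+}$ and satisfies $t\Rightarrow^*_{\mathcal R_{\mathrm{id}}/\mathrm{AC}_+}t'$; in particular $t=_{E_{\mathrm{id,rd}}}t'$.
   Context: $\mathrm{T}(X)$ is the set (and term algebra) of all terms built from elements of $X$, constants $\hat 0,\hat 1$, and binary symbols $\hat+,\hat\times$ (infix). A term $s$ is simple if $s=\hat 0$, or $s$ contains neither $\hat 0$ nor any subterm of the form $\hat 1\hat\times s'$ or $s'\hat\times\hat 1$. $\mathrm{ST}(X)$ is the set of simple terms. For $s,t\in \mathrm{ST}(X)$, $s=_{\mathrm{AC}}t$ means that $t$ is obtained from $s$ by finitely many steps, each replacing a subterm occurrence using, in either direction, one of: $a\hat+(b\hat+c)\leftrightarrow(a\hat+b)\hat+c$, $a\hat+b\leftrightarrow b\hat+a$, $a\hat\times(b\hat\times c)\leftrightarrow(a\hat\times b)\hat\times c$. A monomial term is a term built from elements of $X$ using only $\hat\times$. The set $\mathrm{PT}(X)$ of polynomial terms is the smallest $U\subseteq \mathrm{ST}(X)$ with: (a) $\hat 0,\hat 1$ and all monomial terms are in $U$; (b) if $s,t\in U\setminus\{\hat 0\}$ then $s\hat+t\in U$; (c) if $s$ is a monomial term and $t\in U\setminus\{\hat 0,\hat 1\}$ then $s\hat\times t\in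 U$. A sum term is a simple term $s_1\hat+s_2$ with $s_1,s_2\in \mathrm{ST}(X)\setminus\{\hat 0\}$; a product term is a simple term $s_1\hat\times s_2$ with $s_1,s_2\in \mathrm{ST}(X)\setminus\{\hat0,\hat1\}$. Each sum term is, up to omitted parentheses, uniquely $t_1\hat+\cdots\hat+t_n$ ($n\ge2$) with every $t_i$ a product term or in $X\cup\{\hat 1\}$ (its sum-product decomposition). $\mathrm{ST}_{\mathrm{id}}(X)$ is the smallest $U\subseteq \mathrm{ST}(X)$ with: (a) $\hat0,\hat1$ and all monomial terms are in $U$; (b) if $t$ is a sum term with sum-product decomposition $t_1\hat+\cdots\hat+t_n$, all $t_i\in U$, and $t_i\neq_{\mathrm{AC}}t_j$ for $i<j$, then $t\in U$; (c) if $s,t\in U\setminus\{\hat0,\hat1\}$ then $s\hat\times t\in U$. $\mathrm{PT}_{\mathrm{id}}(X)=\mathrm{PT}(X)\cap \mathrm{ST}_{\mathrm{id}}(X)$ is the set of id-reduced polynomial terms. $\mathcal R_{\mathrm{id}}$ is the term rewriting system with rules $\hat0\hat+z\to z$, $z\hat+\hat0\to z$, $\hat1\hat\times z\to z$, $z\hat\times\hat1\to z$, $\hat0\hat\times z\to\hat0$, $z\hat\times\hat0\to\hat0$, $(z_1\hat\times z_2)\hat\times z_3\to z_1\hat\times(z_2\hat\times z_3)$, $(z_1\hat+z_2)\hat\times z_3\to(z_1\hat\times z_3)\hat+(z_2\hat\times z_3)$, $z\hat+z\to z$ (elements of $X$ are constants; $z,z_i$ are variables substituted by arbitrary terms). $s\Rightarrow_{\mathcal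 R_{\mathrm{id}}}t$ means $t$ arises from $s$ by replacing one subterm occurrence that is an instance of a left-hand side by the corresponding instance of the right-hand side. $=_{\mathrm{AC}_+}$ is the smallest congruence on $\mathrm{T}(X)$ containing all pairs $(a\hat+(b\hat+c),(a\hat+b)\hat+c)$ and $(a\hat+b,b\hat+a)$. $s\Rightarrow_{\mathcal R_{\mathrm{id}}/\mathrm{AC}_+}t$ means there are $s',t'$ with $s=_{\mathrm{AC}_+}s'\Rightarrow_{\mathcal R_{\mathrm{id}}}t'=_{\mathrm{AC}_+}t$; $\Rightarrow^*$ denotes reflexive-transitive closure; a term is in normal form for a relation if no step of the relation starts from it. $=_{E_{\mathrm{id,rd}}}$ is the smallest congruence on the term algebra $\mathrm{T}(X)$ containing, for all $a,b,c\in \mathrm{T}(X)$, the pairs $(a\hat+(b\hat+c),(a\hat+b)\hat+c)$, $(a\hat+b,b\hat+a)$, $(a\hat+\hat0,a)$, $(a\hat\times(b\hat\times c),(a\hat\times b)\hat\times c)$, $(\hat1\hat\times a,a)$, $(a\hat\times\hat1,a)$, $(a\hat\times\hat0,\hat0)$, $(\hat0\hat\times a,\hat0)$, $((a\hat+b)\hat\times c,(a\hat\times c)\hat+(b\hat\times c))$, $(a\hat+a,a)$. *)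

theory Defs
  imports Main
begin

datatype (atoms: 'x) trm =
    Atom 'x
  | Zero ("\<^bold>0")
  | One ("\<^bold>1")
  | Add "'x trm" "'x trm" (infixl "\<^bold>+" 65)
  | Mul "'x trm" "'x trm" (infixl "\<^bold>\<times>" 70)

definition terms :: "'x set \<Rightarrow> 'x trm set" where
  "terms X = {t. atoms t \<subseteq> X}"

fun subterms :: "'x trm \<Rightarrow> 'x trm set" where
  "subterms (s \<^bold>+ t) = {s \<^bold>+ t} \<union> subterms s \<union> subterms t"
| "subterms (s \<^bold>\<times> t) = {s \<^bold>\<times> t} \<union> subterms s \<union> subterms t"
| "subterms t = {t}"

definition simple :: "'x trm \<Rightarrow> bool" where
  "simple s \<longleftrightarrow> s = \<^bold>0 \<or>
     (\<^bold>0 \<notin> subterms s \<and> (\<forall>s'. \<^bold>1 \<^bold>\<times> s' \<notin> subterms s \<and> s' \<^bold>\<times> \<^bold>1 \<notin> subterms s))"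

definition ST :: "'x set \<Rightarrow> 'x trm set" where
  "ST X = {s \<in> terms X. simple s}"

text \<open>Replacement of one subterm occurrence according to the root relation \<open>R\<close>.\<close>

inductive rewrite_step :: "('x trm \<Rightarrow> 'x trm \<Rightarrow> bool) \<Rightarrow> 'x trm \<Rightarrow> 'x trm \<Rightarrow> bool"
  for R where
  root: "R s t \<Longrightarrow> rewrite_step R s t"
| add_left: "rewrite_step R s t \<Longrightarrow> rewrite_step R (s \<^bold>+ u) (t \<^bold>+ u)"
| add_right: "rewrite_step R s t \<Longrightarrow> rewrite_step R (u \<^bold>+ s) (u \<^bold>+ t)"
| mul_left: "rewrite_step R s t \<Longrightarrow> rewrite_step R (s \<^bold>\<times> u) (t \<^bold>\<times> u)"
| mul_right: "rewrite_step R s t \<Longrightarrow> rewrite_step R (u \<^bold>\<times> s) (u \<^bold>\<times> t)"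

inductive gen_congruence ::
    "'x set \<Rightarrow> ('x trm \<Rightarrow> 'x trm \<Rightarrow> bool) \<Rightarrow> 'x trm \<Rightarrow> 'x trm \<Rightarrow> bool"
  for X R where
  base: "s \<in> terms X \<Longrightarrow> t \<in> terms X \<Longrightarrow> R s t \<Longrightarrow> gen_congruence X R s t"
| refl: "s \<in> terms X \<Longrightarrow> gen_congruence X R s s"
| sym: "gen_congruence X R s t \<Longrightarrow> gen_congruence X R t s"
| trans: "gen_congruence X R s t \<Longrightarrow> gen_congruence X R t u \<Longrightarrow> gen_congruence X R s u"
| add: "gen_congruence X R s s' \<Longrightarrow> gen_congruence X R t t'
    \<Longrightarrow> gen_congruence X R (s \<^bold>+ t) (s' \<^bold>+ t')"
| mul: "gen_congruence X R s s' \<Longrightarrow> gen_congruence X R t t'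
    \<Longrightarrow> gen_congruence X R (s \<^bold>\<times> t) (s' \<^bold>\<times> t')"

inductive AC_axiom :: "'x trm \<Rightarrow> 'x trm \<Rightarrow> bool" where
  "AC_axiom (a \<^bold>+ (b \<^bold>+ c)) ((a \<^bold>+ b) \<^bold>+ c)"
| "AC_axiom (a \<^bold>+ b) (b \<^bold>+ a)"
| "AC_axiom (a \<^bold>\<times> (b \<^bold>\<times> c)) ((a \<^bold>\<times> b) \<^bold>\<times> c)"

text \<open>\<open>AC\<close> is defined on all terms; a step preserves simplicity and the set of atoms, so
  restricting it to simple terms over \<open>X\<close> needs no condition on the intermediate terms.\<close>

definition AC :: "'x trm \<Rightarrow> 'x trm \<Rightarrow> bool" where
  "AC = (symclp (rewrite_step AC_axiom))\<^sup>*\<^sup>*"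

inductive_set monomials :: "'x set \<Rightarrow> 'x trm set" for X where
  "x \<in> X \<Longrightarrow> Atom x \<in> monomials X"
| "s \<in> monomials X \<Longrightarrow> t \<in> monomials X \<Longrightarrow> s \<^bold>\<times> t \<in> monomials X"

inductive_set PT :: "'x set \<Rightarrow> 'x trm set" for X where
  zero: "\<^bold>0 \<in> PT X"
| one: "\<^bold>1 \<in> PT X"
| monomial: "s \<in> monomials X \<Longrightarrow> s \<in> PT X"
| add: "s \<in> PT X \<Longrightarrow> t \<in> PT X \<Longrightarrow> s \<noteq> \<^bold>0 \<Longrightarrow> t \<noteq> \<^bold>0 \<Longrightarrow> s \<^bold>+ t \<in> PT X"
| mul: "s \<in> monomials X \<Longrightarrow> t \<in> PT X \<Longrightarrow> t \<notin> {\<^bold>0, \<^bold>1} \<Longrightarrow> s \<^bold>\<times> t \<in> PT X"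

definition sum_terms :: "'x set \<Rightarrow> 'x trm set" where
  "sum_terms X = {s\<^sub>1 \<^bold>+ s\<^sub>2 | s\<^sub>1 s\<^sub>2. s\<^sub>1 \<in> ST X - {\<^bold>0} \<and> s\<^sub>2 \<in> ST X - {\<^bold>0}}"

definition product_terms :: "'x set \<Rightarrow> 'x trm set" where
  "product_terms X =
     {s\<^sub>1 \<^bold>\<times> s\<^sub>2 | s\<^sub>1 s\<^sub>2. s\<^sub>1 \<in> ST X - {\<^bold>0, \<^bold>1} \<and> s\<^sub>2 \<in> ST X - {\<^bold>0, \<^bold>1}}"

text \<open>\<open>bracketed_sum ts t\<close>: the term \<open>t\<close> is \<open>t\<^sub>1 \<^bold>+ \<dots> \<^bold>+ t\<^sub>n\<close> with some choice of parentheses,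
  where \<open>ts = [t\<^sub>1, \<dots>, t\<^sub>n]\<close>.\<close>

inductive bracketed_sum :: "'x trm list \<Rightarrow> 'x trm \<Rightarrow> bool" where
  single: "bracketed_sum [t] t"
| add: "bracketed_sum ss s \<Longrightarrow> bracketed_sum ts t \<Longrightarrow> bracketed_sum (ss @ ts) (s \<^bold>+ t)"

definition sum_product_decomposition :: "'x set \<Rightarrow> 'x trm \<Rightarrow> 'x trm list \<Rightarrow> bool" where
  "sum_product_decomposition X t ts \<longleftrightarrow>
     length ts \<ge> 2 \<and> bracketed_sum ts t \<and> set ts \<subseteq> product_terms X \<union> Atom ` X \<union> {\<^bold>1}"

inductive_set ST_id :: "'x set \<Rightarrow> 'x trm set" for X where
  zero: "\<^bold>0 \<in> ST_id X"
| one: "\<^bold>1 \<in> ST_id X"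
| monomial: "s \<in> monomials X \<Longrightarrow> s \<in> ST_id X"
| sum: "t \<in> sum_terms X \<Longrightarrow> sum_product_decomposition X t ts
    \<Longrightarrow> (\<forall>u \<in> set ts. u \<in> ST_id X)
    \<Longrightarrow> (\<forall>i j. i < j \<and> j < length ts \<longrightarrow> \<not> AC (ts ! i) (ts ! j))
    \<Longrightarrow> t \<in> ST_id X"
| mul: "s \<in> ST_id X \<Longrightarrow> t \<in> ST_id X \<Longrightarrow> s \<notin> {\<^bold>0, \<^bold>1} \<Longrightarrow> t \<notin> {\<^bold>0, \<^bold>1}
    \<Longrightarrow> s \<^bold>\<times> t \<in> ST_id X"

definition PT_id :: "'x set \<Rightarrow> 'x trm set" where
  "PT_id X = PT X \<inter> ST_id X"

inductive R_id :: "'x trm \<Rightarrow> 'x trm \<Rightarrow> bool" where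
  "R_id (\<^bold>0 \<^bold>+ z) z"
| "R_id (z \<^bold>+ \<^bold>0) z"
| "R_id (\<^bold>1 \<^bold>\<times> z) z"
| "R_id (z \<^bold>\<times> \<^bold>1) z"
| "R_id (\<^bold>0 \<^bold>\<times> z) \<^bold>0"
| "R_id (z \<^bold>\<times> \<^bold>0) \<^bold>0"
| "R_id ((z\<^sub>1 \<^bold>\<times> z\<^sub>2) \<^bold>\<times> z\<^sub>3) (z\<^sub>1 \<^bold>\<times> (z\<^sub>2 \<^bold>\<times> z\<^sub>3))"
| "R_id ((z\<^sub>1 \<^bold>+ z\<^sub>2) \<^bold>\<times> z\<^sub>3) ((z\<^sub>1 \<^bold>\<times> z\<^sub>3) \<^bold>+ (z\<^sub>2 \<^bold>\<times> z\<^sub>3))"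
| "R_id (z \<^bold>+ z) z"

inductive AC_plus_axiom :: "'x trm \<Rightarrow> 'x trm \<Rightarrow> bool" where
  "AC_plus_axiom (a \<^bold>+ (b \<^bold>+ c)) ((a \<^bold>+ b) \<^bold>+ c)"
| "AC_plus_axiom (a \<^bold>+ b) (b \<^bold>+ a)"

definition AC_plus :: "'x set \<Rightarrow> 'x trm \<Rightarrow> 'x trm \<Rightarrow> bool" where
  "AC_plus X = gen_congruence X AC_plus_axiom"

definition R_id_mod_AC_plus :: "'x set \<Rightarrow> 'x trm \<Rightarrow> 'x trm \<Rightarrow> bool" where
  "R_id_mod_AC_plus X s t \<longleftrightarrow>
     (\<exists>s' t'. AC_plus X s s' \<and> rewrite_step R_id s' t' \<and> AC_plus X t' t)"

definition normal_form :: "('x trm \<Rightarrow> 'x trm \<Rightarrow> bool) \<Rightarrow> 'x trm \<Rightarrow> bool" where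
  "normal_form R t \<longleftrightarrow> \<not> (\<exists>u. R t u)"

inductive E_id_rd_axiom :: "'x trm \<Rightarrow> 'x trm \<Rightarrow> bool" where
  "E_id_rd_axiom (a \<^bold>+ (b \<^bold>+ c)) ((a \<^bold>+ b) \<^bold>+ c)"
| "E_id_rd_axiom (a \<^bold>+ b) (b \<^bold>+ a)"
| "E_id_rd_axiom (a \<^bold>+ \<^bold>0) a"
| "E_id_rd_axiom (a \<^bold>\<times> (b \<^bold>\<times> c)) ((a \<^bold>\<times> b) \<^bold>\<times> c)"
| "E_id_rd_axiom (\<^bold>1 \<^bold>\<times> a) a"
| "E_id_rd_axiom (a \<^bold>\<times> \<^bold>1) a"
| "E_id_rd_axiom (a \<^bold>\<times> \<^bold>0) \<^bold>0"
| "E_id_rd_axiom (\<^bold>0 \<^bold>\<times> a) \<^bold>0"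
| "E_id_rd_axiom ((a \<^bold>+ b) \<^bold>\<times> c) ((a \<^bold>\<times> c) \<^bold>+ (b \<^bold>\<times> c))"
| "E_id_rd_axiom (a \<^bold>+ a) a"

definition E_id_rd :: "'x set \<Rightarrow> 'x trm \<Rightarrow> 'x trm \<Rightarrow> bool" where
  "E_id_rd X = gen_congruence X E_id_rd_axiom"


text \<open>The inductive definitions above stay inside \<open>ST X\<close>, and the sum-product decomposition
  of a sum term exists and is unique.\<close>

lemma ST_simps:
  "\<^bold>0 \<in> ST X" "\<^bold>1 \<in> ST X" "Atom x \<in> ST X \<longleftrightarrow> x \<in> X"
  "s \<^bold>+ t \<in> ST X \<longleftrightarrow> s \<in> ST X - {\<^bold>0} \<and> t \<in> ST X - {\<^bold>0}"
  "s \<^bold>\<times> t \<in> ST X \<longleftrightarrow> s \<in> ST X - {\<^bold>0, \<^bold>1} \<and> t \<in> ST X - {\<^bold>0, \<^bold>1}"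
proof -
  have self: "u \<in> subterms u" for u :: "'x trm" by (cases u) auto
  show "\<^bold>0 \<in> ST X" "\<^bold>1 \<in> ST X" "Atom x \<in> ST X \<longleftrightarrow> x \<in> X"
    by (auto simp: ST_def terms_def simple_def)
  show "s \<^bold>+ t \<in> ST X \<longleftrightarrow> s \<in> ST X - {\<^bold>0} \<and> t \<in> ST X - {\<^bold>0}"
    using self[of s] self[of t] by (auto simp: ST_def terms_def simple_def)
  show "s \<^bold>\<times> t \<in> ST X \<longleftrightarrow> s \<in> ST X - {\<^bold>0, \<^bold>1} \<and> t \<in> ST X - {\<^bold>0, \<^bold>1}"
    using self[of s] self[of t] by (auto simp: ST_def terms_def simple_def)
qed

lemma monomials_subset_ST: "monomials X \<subseteq> ST X - {\<^bold>0, \<^bold>1}"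
proof
  fix s assume "s \<in> monomials X"
  then show "s \<in> ST X - {\<^bold>0, \<^bold>1}" by induction (auto simp: ST_simps)
qed

lemma PT_subset_ST: "PT X \<subseteq> ST X"
proof
  fix s assume "s \<in> PT X"
  then show "s \<in> ST X" using monomials_subset_ST[of X] by induction (auto simp: ST_simps)
qed

lemma ST_id_subset_ST: "ST_id X \<subseteq> ST X"
proof
  fix s assume "s \<in> ST_id X"
  then show "s \<in> ST X" using monomials_subset_ST[of X]
    by induction (auto simp: ST_simps sum_terms_def)
qed

lemma sum_product_decomposition_ex1:
  assumes "t \<in> sum_terms X"
  shows "\<exists>!ts. sum_product_decomposition X t ts"
proof -
  let ?A = "product_terms X \<union> Atom ` X \<union> {\<^bold>1}"
  have noadd: "u \<^bold>+ v \<notin> ?A" for u v by (auto simp: product_terms_def)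
  have ne: "length ts \<ge> 1" if "bracketed_sum ts u" for ts and u :: "'x trm"
    using that by induction auto
  have ex: "\<exists>ts. bracketed_sum ts u \<and> set ts \<subseteq> ?A" if "u \<in> ST X - {\<^bold>0}" for u
    using that
  proof (induction u)
    case (Add u v)
    then obtain us vs where "bracketed_sum us u" "set us \<subseteq> ?A" "bracketed_sum vs v" "set vs \<subseteq> ?A"
      by (auto simp: ST_simps)
    then show ?case by (intro exI[of _ "us @ vs"]) (auto intro: bracketed_sum.add)
  next
    case (Atom x)
    then show ?case by (intro exI[of _ "[Atom x]"]) (auto simp: ST_simps intro: bracketed_sum.single)
  next
    case One
    then show ?case by (intro exI[of _ "[One]"]) (auto intro: bracketed_sum.single)
  next
    case (Mul u v)
    then show ?case
      by (intro exI[of _ "[Mul u v]"])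
        (auto simp: ST_simps product_terms_def intro: bracketed_sum.single)
  qed auto
  have uniq: "ss = ts"
    if "bracketed_sum ss u" "bracketed_sum ts u" "set ss \<subseteq> ?A" "set ts \<subseteq> ?A" for ss ts u
    using that
  proof (induction arbitrary: ts)
    case (single u)
    from single.prems(1) show ?case using single.prems noadd by cases auto
  next
    case (add us u vs v)
    from add.prems(1) show ?case
    proof cases
      case single
      then show ?thesis using add.prems noadd by auto
    next
      case (add us' vs')
      then show ?thesis
        using "add.IH"(1)[of us'] "add.IH"(2)[of vs'] "add.prems" by auto
    qed
  qed
  from assms obtain u v where t: "t = u \<^bold>+ v" "u \<in> ST X - {\<^bold>0}" "v \<in> ST X - {\<^bold>0}"
    by (auto simp: sum_terms_def)
  obtain us vs where *: "bracketed_sum us u" "set us \<subseteq> ?A" "bracketed_sum vs v" "set vs \<subseteq> ?A"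
    using ex[OF t(2)] ex[OF t(3)] by blast
  have "sum_product_decomposition X t (us @ vs)"
    using * ne[OF *(1)] ne[OF *(3)] t(1)
    by (auto simp: sum_product_decomposition_def intro: bracketed_sum.add)
  then show ?thesis
    using uniq unfolding sum_product_decomposition_def by blast
qed

end

theory Submission
  imports Defs "HOL-Library.FSet"
begin

text \<open>
  Rewriting modulo \<open>AC\<^sub>+\<close> is sound for the equations, so uniqueness follows from a model of these
  equations in which normal forms can be told apart up to \<open>AC\<^sub>+\<close>. The model is in essence the free
  algebra of the equational theory, presented concretely: a value is a finite set of summands, and
  a summand is either \<open>1\<close> or a product of an atom \<open>x\<close> with a nonempty value. There is
  no left distributivity, so the value behind an atom stays packed together; this is why
  summands and values are mutually nested. Addition is union, and the map \<open>val\<close> from terms into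
  the model is invariant under rewriting and under both AC congruences.

  The normal forms are \<open>0\<close> and the terms called \<open>reduced\<close> below: products have an
  atom on the left, no \<open>0\<close> occurs, no factor is \<open>1\<close>, and the two sides of every sum have disjoint
  values. The last condition says that no two summands of a sum have the same value. It makes
  all three remaining points inductive. First, reduced terms with the same value are equal modulo
  \<open>AC\<^sub>+\<close> (\<open>reduced_unique\<close>): if \<open>s\<^sub>1 + s\<^sub>2\<close> has the value of \<open>t\<close>, then the summands of \<open>t\<close> can be
  rearranged into two groups with the values of \<open>s\<^sub>1\<close> and \<open>s\<^sub>2\<close>. Second, sums and products of
  reduced terms reduce to reduced terms, so every term reduces to \<open>0\<close> or a reduced term by
  structural induction (\<open>reduces_to_reduced\<close>), which avoids proving termination. Third, \<open>reduced\<close>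
  is stable under \<open>AC\<^sub>+\<close> and excludes every redex, a redex \<open>z + z\<close> because the
  value of \<open>z\<close> is nonempty; hence reduced terms are exactly the nonzero normal forms.

  Finally, equality modulo \<open>AC\<close> also preserves \<open>val\<close>, although it includes associativity of the
  product. So the summands of a reduced term are pairwise distinct modulo \<open>AC\<close>, as id-reduced
  polynomial terms require.
\<close>

section \<open>A model of the equations\<close>

text \<open>The summand \<open>Pre x N\<close> stands for the product of \<open>x\<close> with the sum of \<open>N\<close>. The atom \<open>x\<close> itself is
\<open>Pre x {|Unit|}\<close>, that is \<open>x \<times> 1\<close>, so that no third kind of summand is required.\<close>

datatype 'x summand = Unit | Pre 'x "'x summand fset"

text \<open>Left multiplication by an atom. The case distinction imposes \<open>x \<times> 0 = 0\<close>; a summand \<open>Pre x {||}\<close>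
would be a spurious nonzero value.\<close>

definition prefixed :: "'x \<Rightarrow> 'x summand fset \<Rightarrow> 'x summand fset" where
  "prefixed x N = (if N = {||} then {||} else {|Pre x N|})"

primrec summand_times :: "'x summand \<Rightarrow> 'x summand fset \<Rightarrow> 'x summand fset" where
  "summand_times Unit M = M"
| "summand_times (Pre x N) M = prefixed x (ffUnion ((\<lambda>i. summand_times i M) |`| N))"

definition val_times :: "'x summand fset \<Rightarrow> 'x summand fset \<Rightarrow> 'x summand fset" where
  "val_times N M = ffUnion ((\<lambda>i. summand_times i M) |`| N)"

fun val :: "'x trm \<Rightarrow> 'x summand fset" where
  "val (Atom x) = {|Pre x {|Unit|}|}"
| "val \<^bold>0 = {||}"
| "val \<^bold>1 = {|Unit|}"
| "val (s \<^bold>+ t) = val s |\<union>| val t"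
| "val (s \<^bold>\<times> t) = val_times (val s) (val t)"

lemma val_times_simps [simp]:
  "val_times {||} M = {||}"
  "val_times (finsert i N) M = summand_times i M |\<union>| val_times N M"
  "val_times (N |\<union>| N') M = val_times N M |\<union>| val_times N' M"
  by (simp_all add: val_times_def fimage_funion)

lemma summand_times_Pre [simp]: "summand_times (Pre x N) M = prefixed x (val_times N M)"
  by (simp add: val_times_def)

text \<open>The derived equation above, phrased with \<open>val_times\<close>, replaces the primitive one in rewriting.\<close>

declare summand_times.simps(2) [simp del]

lemma prefixed_empty [simp]: "prefixed x {||} = {||}"
  by (simp add: prefixed_def)

lemma val_times_zero_right [simp]: "val_times N {||} = {||}"
proof -
  have *: "val_times N {||} = {||}" if "\<And>i. i |\<in>| N \<Longrightarrow> summand_times i {||} = {||}" for N :: "'x summand fset"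
    using that by (induction N) simp_all
  have "summand_times i {||} = {||}" for i :: "'x summand"
    by (induction i) (simp_all add: *)
  then show ?thesis by (rule *)
qed

lemma val_times_prefixed: "val_times (prefixed x N) M = prefixed x (val_times N M)"
  by (simp add: prefixed_def)

text \<open>Associativity on values follows from associativity on summands by right distributivity, and on a
summand \<open>Pre x N\<close> it follows from the value-level law for \<open>N\<close>. The local fact is the first of
these implications, needed for the induction on summands and for the conclusion.\<close>

lemma val_times_assoc: "val_times (val_times N M) K = val_times N (val_times M K)"
proof -
  have *: "val_times (val_times N M) K = val_times N (val_times M K)"
    if "\<And>i. i |\<in>| N \<Longrightarrow> val_times (summand_times i M) K = summand_times i (val_times M K)" for N
    using that by (induction N) simp_all
  have "val_times (summand_times i M) K = summand_times i (val_times M K)" for i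
    by (induction i) (simp_all add: * val_times_prefixed)
  then show ?thesis by (rule *)
qed

text \<open>The right unit law fails for junk such as \<open>{|Pre x {||}|}\<close>, which no term denotes. Restricting to
values of terms replaces a well-formedness invariant: products reduce to their right factor by
associativity.\<close>

lemma val_times_val_one: "val_times (val t) {|Unit|} = val t"
  by (induction t) (auto simp: prefixed_def val_times_assoc)

lemma val_R_id: "rewrite_step R_id s t \<Longrightarrow> val s = val t"
proof (induction rule: rewrite_step.induct)
  case (root s t)
  then show ?case by cases (auto simp: val_times_assoc val_times_val_one)
qed auto

text \<open>Equality modulo \<open>AC\<close> is coarser than modulo \<open>AC\<^sub>+\<close>, but the model cannot tell them apart. This
later turns disjointness of values into pairwise distinctness modulo \<open>AC\<close>.\<close>

lemma val_AC: "AC s t \<Longrightarrow> val s = val t"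
proof -
  have step: "val s = val t" if "rewrite_step AC_axiom s t" for s t :: "'x trm"
    using that
  proof (induction rule: rewrite_step.induct)
    case (root s t)
    then show ?case by cases (auto simp: val_times_assoc)
  qed auto
  assume "AC s t"
  then show ?thesis unfolding AC_def
    by induction (auto simp: symclp_def dest: step)
qed

lemma val_AC_plus: "AC_plus X s t \<Longrightarrow> val s = val t"
  unfolding AC_plus_def
proof (induction rule: gen_congruence.induct)
  case (base s t)
  from base(3) show ?case by cases auto
qed auto

lemma val_R_id_mod_star:
  assumes "(R_id_mod_AC_plus X)\<^sup>*\<^sup>* s t"
  shows "val s = val t"
  using assms
  by induction (auto simp: R_id_mod_AC_plus_def dest!: val_AC_plus val_R_id)


section \<open>Restricting to a set of atoms\<close>

text \<open>
  With all atoms allowed, reflexivity and congruence need no side conditions. The arguments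
  below therefore take place over the full set of atoms, and the two restriction lemmas bring the
  results back to \<open>X\<close>: neither \<open>AC\<^sub>+\<close> nor a rewrite step can introduce new atoms.
\<close>

abbreviation ACp :: "'x trm \<Rightarrow> 'x trm \<Rightarrow> bool" (infix "\<approx>" 50) where
  "ACp \<equiv> AC_plus UNIV"

lemma terms_simps [simp]:
  "Atom x \<in> terms X \<longleftrightarrow> x \<in> X" "\<^bold>0 \<in> terms X" "\<^bold>1 \<in> terms X"
  "s \<^bold>+ t \<in> terms X \<longleftrightarrow> s \<in> terms X \<and> t \<in> terms X"
  "s \<^bold>\<times> t \<in> terms X \<longleftrightarrow> s \<in> terms X \<and> t \<in> terms X"
  "t \<in> terms UNIV"
  by (auto simp: terms_def)

lemma AC_plus_UNIV_restrict:
  assumes "s \<approx> t" and "s \<in> terms X"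
  shows "AC_plus X s t \<and> t \<in> terms X"
proof -
  have "(s \<in> terms X \<longleftrightarrow> t \<in> terms X) \<and> (s \<in> terms X \<longrightarrow> AC_plus X s t)"
    using assms(1) unfolding AC_plus_def
  proof (induction rule: gen_congruence.induct)
    case (base s t)
    from base(3) have "s \<in> terms X \<longleftrightarrow> t \<in> terms X" by cases auto
    with base(3) show ?case by (auto intro: gen_congruence.base)
  qed (auto intro: gen_congruence.intros)
  with assms(2) show ?thesis by blast
qed

lemma gen_congruence_terms:
  "gen_congruence X R s t \<Longrightarrow> s \<in> terms X \<and> t \<in> terms X"
  by (induction rule: gen_congruence.induct) auto

lemma rewrite_step_R_id_terms:
  "rewrite_step R_id s t \<Longrightarrow> s \<in> terms X \<Longrightarrow> t \<in> terms X"
proof (induction rule: rewrite_step.induct)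
  case (root s t)
  from root(1) show ?case using root(2) by cases auto
qed auto

abbreviation reduces :: "'x trm \<Rightarrow> 'x trm \<Rightarrow> bool" (infix "\<leadsto>" 50) where
  "reduces \<equiv> (R_id_mod_AC_plus UNIV)\<^sup>*\<^sup>*"

lemma reduces_restrict:
  assumes "s \<leadsto> t" and "s \<in> terms X"
  shows "(R_id_mod_AC_plus X)\<^sup>*\<^sup>* s t \<and> t \<in> terms X"
  using assms(1)
proof induction
  case base
  then show ?case using assms(2) by simp
next
  case (step t u)
  then have t: "t \<in> terms X" by simp
  from step(2) obtain t' u' where "t \<approx> t'" and r: "rewrite_step R_id t' u'" and "u' \<approx> u"
    by (auto simp: R_id_mod_AC_plus_def)
  then have 1: "AC_plus X t t'" "t' \<in> terms X" using AC_plus_UNIV_restrict t by blast+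
  then have "u' \<in> terms X" using rewrite_step_R_id_terms r by blast
  then have "AC_plus X u' u" "u \<in> terms X" using AC_plus_UNIV_restrict \<open>u' \<approx> u\<close> by blast+
  then have "R_id_mod_AC_plus X t u" using 1 r by (auto simp: R_id_mod_AC_plus_def)
  then show ?case using step \<open>u \<in> terms X\<close> by auto
qed


section \<open>Sums and products modulo AC and under reduction\<close>

lemma ACp_refl [simp]: "s \<approx> s"
  and ACp_sym: "s \<approx> t \<Longrightarrow> t \<approx> s"
  and ACp_trans [trans]: "s \<approx> t \<Longrightarrow> t \<approx> u \<Longrightarrow> s \<approx> u"
  and ACp_add: "s \<approx> s' \<Longrightarrow> t \<approx> t' \<Longrightarrow> s \<^bold>+ t \<approx> s' \<^bold>+ t'"
  and ACp_mul: "s \<approx> s' \<Longrightarrow> t \<approx> t' \<Longrightarrow> s \<^bold>\<times> t \<approx> s' \<^bold>\<times> t'"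
  unfolding AC_plus_def by (auto intro: gen_congruence.intros)

lemma ACp_assoc: "a \<^bold>+ (b \<^bold>+ c) \<approx> (a \<^bold>+ b) \<^bold>+ c"
  and ACp_comm: "a \<^bold>+ b \<approx> b \<^bold>+ a"
  unfolding AC_plus_def by (auto intro: gen_congruence.base AC_plus_axiom.intros)

lemma ACp_interchange: "(a \<^bold>+ b) \<^bold>+ (c \<^bold>+ d) \<approx> (a \<^bold>+ c) \<^bold>+ (b \<^bold>+ d)"
proof -
  have "(a \<^bold>+ b) \<^bold>+ (c \<^bold>+ d) \<approx> ((a \<^bold>+ b) \<^bold>+ c) \<^bold>+ d" by (rule ACp_assoc)
  also have "\<dots> \<approx> (a \<^bold>+ (b \<^bold>+ c)) \<^bold>+ d" by (intro ACp_add ACp_sym[OF ACp_assoc] ACp_refl)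
  also have "\<dots> \<approx> (a \<^bold>+ (c \<^bold>+ b)) \<^bold>+ d" by (intro ACp_add ACp_comm ACp_refl)
  also have "\<dots> \<approx> ((a \<^bold>+ c) \<^bold>+ b) \<^bold>+ d" by (intro ACp_add ACp_assoc ACp_refl)
  also have "\<dots> \<approx> (a \<^bold>+ c) \<^bold>+ (b \<^bold>+ d)" by (rule ACp_sym[OF ACp_assoc])
  finally show ?thesis .
qed

text \<open>Both sides of each axiom of \<open>AC\<^sub>+\<close> are sums, so an atom or a constant is alone in its class.\<close>

lemma AC_plus_leaf:
  assumes "AC_plus X s t"
  shows "(s = Atom x \<longleftrightarrow> t = Atom x) \<and> (s = \<^bold>0 \<longleftrightarrow> t = \<^bold>0) \<and> (s = \<^bold>1 \<longleftrightarrow> t = \<^bold>1)"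
  using assms unfolding AC_plus_def
proof (induction rule: gen_congruence.induct)
  case (base s t)
  from base(3) show ?case by cases auto
qed auto

lemma reduces_R_id_modulo_ACp:
  assumes "s \<approx> s'" and "R_id s' t"
  shows "s \<leadsto> t"
proof -
  have "R_id_mod_AC_plus UNIV s t"
    unfolding R_id_mod_AC_plus_def using assms rewrite_step.root ACp_refl by blast
  then show ?thesis by auto
qed

lemma reduces_R_id: "R_id s t \<Longrightarrow> s \<leadsto> t"
  by (rule reduces_R_id_modulo_ACp[OF ACp_refl])

lemma reduces_context:
  assumes "s \<leadsto> t"
    and "\<And>s t. s \<approx> t \<Longrightarrow> C s \<approx> C t"
    and "\<And>s t. rewrite_step R_id s t \<Longrightarrow> rewrite_step R_id (C s) (C t)"
  shows "C s \<leadsto> C t"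
  using assms(1)
proof induction
  case (step t u)
  then have "R_id_mod_AC_plus UNIV (C t) (C u)"
    using assms(2,3) unfolding R_id_mod_AC_plus_def by blast
  then show ?case using step by auto
qed auto

lemma reduces_add:
  assumes "s \<leadsto> s'" and "t \<leadsto> t'"
  shows "s \<^bold>+ t \<leadsto> s' \<^bold>+ t'"
proof -
  have "s \<^bold>+ t \<leadsto> s' \<^bold>+ t"
    by (rule reduces_context[OF assms(1)]) (auto intro: ACp_add rewrite_step.add_left)
  also have "s' \<^bold>+ t \<leadsto> s' \<^bold>+ t'"
    by (rule reduces_context[OF assms(2)]) (auto intro: ACp_add rewrite_step.add_right)
  finally show ?thesis .
qed

lemma reduces_mul:
  assumes "s \<leadsto> s'" and "t \<leadsto> t'"
  shows "s \<^bold>\<times> t \<leadsto> s' \<^bold>\<times> t'"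
proof -
  have "s \<^bold>\<times> t \<leadsto> s' \<^bold>\<times> t"
    by (rule reduces_context[OF assms(1)]) (auto intro: ACp_mul rewrite_step.mul_left)
  also have "s' \<^bold>\<times> t \<leadsto> s' \<^bold>\<times> t'"
    by (rule reduces_context[OF assms(2)]) (auto intro: ACp_mul rewrite_step.mul_right)
  finally show ?thesis .
qed


section \<open>Reduced terms are determined by their value\<close>

text \<open>Zero is excluded so that the predicate is hereditary: it is the one normal form that cannot be
part of another. Disjointness of values is the compositional form of "no two summands are equal".\<close>

fun reduced :: "'x trm \<Rightarrow> bool" where
  "reduced (Atom x) = True"
| "reduced \<^bold>0 = False"
| "reduced \<^bold>1 = True"
| "reduced (s \<^bold>+ t) = (reduced s \<and> reduced t \<and> val s |\<inter>| val t = {||})"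
| "reduced (s \<^bold>\<times> t) = ((\<exists>x. s = Atom x) \<and> reduced t \<and> t \<noteq> \<^bold>1)"

lemma val_Atom_mul: "val t \<noteq> {||} \<Longrightarrow> val (Atom x \<^bold>\<times> t) = {|Pre x (val t)|}"
  by (simp add: prefixed_def)

lemma val_reduced_nonempty: "reduced t \<Longrightarrow> val t \<noteq> {||}"
proof (induction t)
  case (Mul s t)
  then obtain x where "s = Atom x" "reduced t" by auto
  moreover have "val t \<noteq> {||}" using Mul.IH(2) \<open>reduced t\<close> .
  ultimately show ?case by (simp add: val_Atom_mul del: val.simps(5))
qed simp_all

lemma val_reduced_mul:
  assumes "reduced (s \<^bold>\<times> t)"
  shows "\<exists>x. s = Atom x \<and> val (s \<^bold>\<times> t) = {|Pre x (val t)|}"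
proof -
  obtain x where "s = Atom x" "reduced t" using assms by auto
  moreover have "val t \<noteq> {||}" using \<open>reduced t\<close> by (rule val_reduced_nonempty)
  ultimately show ?thesis by (simp add: val_Atom_mul del: val.simps(5))
qed

definition is_sum :: "'x trm \<Rightarrow> bool" where
  "is_sum t \<longleftrightarrow> (\<exists>u v. t = u \<^bold>+ v)"

text \<open>A sum of reduced terms has at least two summands, because both sides contribute a nonempty value
and these are disjoint.\<close>

lemma val_reduced_summand:
  assumes "reduced t"
  shows "(\<exists>i. val t = {|i|}) \<longleftrightarrow> \<not> is_sum t"
proof (cases t)
  case (Add u v)
  have False if "val t = {|i|}" for i
  proof -
    have "val u |\<subseteq>| {|i|}" "val v |\<subseteq>| {|i|}"
      using that Add by auto
    then have "val u = {|i|}" "val v = {|i|}"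
      using assms Add val_reduced_nonempty[of u] val_reduced_nonempty[of v]
      by (auto dest!: fsubset_fsingletonD)
    then show False using assms Add by auto
  qed
  then show ?thesis using Add by (auto simp: is_sum_def)
next
  case (Mul u v)
  then show ?thesis using val_reduced_mul[of u v] assms by (auto simp: is_sum_def simp del: val.simps(5))
qed (use assms in \<open>auto simp: is_sum_def\<close>)

text \<open>Selecting some of the summands of a term may leave none. Representing the empty selection by \<open>0\<close>
and adding with \<open>0\<close> as a neutral element keeps the selection compositional, although \<open>AC\<^sub>+\<close>
has no unit law.\<close>

definition sum0 :: "'x trm \<Rightarrow> 'x trm \<Rightarrow> 'x trm" (infixl "\<oplus>" 65) where
  "s \<oplus> t = (if s = \<^bold>0 then t else if t = \<^bold>0 then s else s \<^bold>+ t)"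

text \<open>The sub-sum of those summands whose value lies in \<open>P\<close>.\<close>

fun part_in :: "'x summand set \<Rightarrow> 'x trm \<Rightarrow> 'x trm" where
  "part_in P (s \<^bold>+ t) = part_in P s \<oplus> part_in P t"
| "part_in P t = (if fset (val t) \<subseteq> P then t else \<^bold>0)"

lemma part_in_summand:
  "\<not> is_sum t \<Longrightarrow> part_in P t = (if fset (val t) \<subseteq> P then t else \<^bold>0)"
  by (cases t) (auto simp: is_sum_def)

lemma val_sum0 [simp]: "val (s \<oplus> t) = val s |\<union>| val t"
  by (auto simp: sum0_def)

text \<open>Induction over the additive structure only: a product is a base case, known just by its
one-element value.\<close>

lemma reduced_sum_induct [case_names summand add, consumes 1]:
  assumes "reduced t"
    and "\<And>t i. reduced t \<Longrightarrow> \<not> is_sum t \<Longrightarrow> val t = {|i|} \<Longrightarrow> Q t"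
    and "\<And>u v. reduced u \<Longrightarrow> reduced v \<Longrightarrow> val u |\<inter>| val v = {||} \<Longrightarrow> Q u \<Longrightarrow> Q v \<Longrightarrow> Q (u \<^bold>+ v)"
  shows "Q t"
  using assms(1)
proof (induction "size t" arbitrary: t rule: less_induct)
  case less
  show ?case
  proof (cases "is_sum t")
    case True
    then show ?thesis using less assms(3) by (auto simp: is_sum_def)
  next
    case False
    then show ?thesis using less.prems assms(2) val_reduced_summand by blast
  qed
qed

lemma part_in_reduced:
  assumes "reduced t"
  shows "(part_in P t = \<^bold>0 \<or> reduced (part_in P t)) \<and> fset (val (part_in P t)) = fset (val t) \<inter> P"
  using assms
proof (induction rule: reduced_sum_induct)
  case (summand t i)
  then show ?case by (auto simp: part_in_summand)
next
  case (add u v)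
  then have "val (part_in P u) |\<inter>| val (part_in P v) = {||}" by auto
  then have "part_in P (u \<^bold>+ v) = \<^bold>0 \<or> reduced (part_in P (u \<^bold>+ v))"
    using add.IH by (cases "part_in P u = \<^bold>0"; cases "part_in P v = \<^bold>0") (simp_all add: sum0_def)
  moreover have "fset (val (part_in P (u \<^bold>+ v))) = fset (val (u \<^bold>+ v)) \<inter> P"
    using add.IH by (simp add: Int_Un_distrib2)
  ultimately show ?case ..
qed

lemma ACp_sum0_interchange: "(a \<oplus> b) \<oplus> (c \<oplus> d) \<approx> (a \<oplus> c) \<oplus> (b \<oplus> d)"
proof (cases "a = \<^bold>0 \<or> b = \<^bold>0 \<or> c = \<^bold>0 \<or> d = \<^bold>0")
  case True
  \<comment> \<open>What remains when only the last or only the first of the four terms is \<open>0\<close>; in the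
    middle, a single \<open>0\<close> leaves an instance of associativity.\<close>
  have 1: "(a \<^bold>+ b) \<^bold>+ c \<approx> (a \<^bold>+ c) \<^bold>+ b" for a b c :: "'x trm"
    by (metis ACp_add ACp_assoc ACp_comm ACp_refl ACp_sym ACp_trans)
  have 2: "a \<^bold>+ (b \<^bold>+ c) \<approx> b \<^bold>+ (a \<^bold>+ c)" for a b c :: "'x trm"
    by (metis ACp_add ACp_assoc ACp_comm ACp_refl ACp_sym ACp_trans)
  show ?thesis using True
    by (auto simp: sum0_def intro: ACp_comm ACp_assoc ACp_sym[OF ACp_assoc] 1 2)
next
  case False
  then show ?thesis using ACp_interchange by (auto simp: sum0_def)
qed

text \<open>Separating the summands in \<open>P\<close> from the others is a rearrangement; each step of the
induction on sums swaps the two middle groups.\<close>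

lemma ACp_parts:
  assumes "reduced t"
  shows "t \<approx> part_in P t \<oplus> part_in (- P) t"
  using assms
proof (induction rule: reduced_sum_induct)
  case (summand t i)
  then show ?case by (auto simp: part_in_summand sum0_def)
next
  case (add u v)
  have "u \<noteq> \<^bold>0" "v \<noteq> \<^bold>0" using add by auto
  then have "part_in P u \<oplus> part_in (- P) u \<noteq> \<^bold>0" "part_in P v \<oplus> part_in (- P) v \<noteq> \<^bold>0"
    using AC_plus_leaf[OF add.IH(1)] AC_plus_leaf[OF add.IH(2)] by simp_all
  then have "u \<^bold>+ v \<approx> (part_in P u \<oplus> part_in (- P) u) \<oplus> (part_in P v \<oplus> part_in (- P) v)"
    using ACp_add[OF add.IH] by (simp add: sum0_def[of "_ \<oplus> _" "_ \<oplus> _"])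
  also have "\<dots> \<approx> part_in P (u \<^bold>+ v) \<oplus> part_in (- P) (u \<^bold>+ v)"
    by (simp add: ACp_sum0_interchange)
  finally show ?case .
qed

text \<open>A partition of the value of a term lifts to a rearrangement of the term itself. This is the key to
uniqueness, and also exposes a duplicate summand so that idempotency applies.\<close>

lemma reduced_split:
  assumes "reduced t" "val t = A |\<union>| B" "A |\<inter>| B = {||}" "A \<noteq> {||}" "B \<noteq> {||}"
  shows "\<exists>a b. reduced a \<and> reduced b \<and> val a = A \<and> val b = B \<and> t \<approx> a \<^bold>+ b"
proof -
  let ?a = "part_in (fset A) t" and ?b = "part_in (- fset A) t"
  have "fset (val ?a) = fset A" "fset (val ?b) = fset B"
    using part_in_reduced[OF assms(1), of "fset A"] part_in_reduced[OF assms(1), of "- fset A"]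
      assms(2,3) by auto
  then have v: "val ?a = A" "val ?b = B" by (auto simp: fset_inject)
  then have "?a \<noteq> \<^bold>0" "?b \<noteq> \<^bold>0" using assms(4,5) by (metis val.simps(2))+
  then have "reduced ?a" "reduced ?b" "t \<approx> ?a \<^bold>+ ?b"
    using part_in_reduced[OF assms(1), of "fset A"] part_in_reduced[OF assms(1), of "- fset A"]
      ACp_parts[OF assms(1), of "fset A"] by (simp_all add: sum0_def)
  with v show ?thesis by blast
qed

lemma reduced_val_Unit:
  assumes "reduced t" "val t = {|Unit|}"
  shows "t = \<^bold>1"
proof -
  have "\<not> is_sum t" using assms val_reduced_summand by blast
  then show ?thesis
  proof (cases t)
    case (Mul u v)
    then show ?thesis using val_reduced_mul[of u v] assms by (auto simp del: val.simps(5))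
  qed (use assms in \<open>auto simp: is_sum_def\<close>)
qed

lemma reduced_val_Pre:
  assumes "reduced t" "val t = {|Pre x N|}"
  shows "t = Atom x \<and> N = {|Unit|} \<or> (\<exists>u. t = Atom x \<^bold>\<times> u \<and> reduced u \<and> u \<noteq> \<^bold>1 \<and> val u = N)"
proof -
  have "\<not> is_sum t" using assms val_reduced_summand by blast
  then show ?thesis
  proof (cases t)
    case (Mul u v)
    then show ?thesis using val_reduced_mul[of u v] assms by (auto simp del: val.simps(5))
  qed (use assms in \<open>auto simp: is_sum_def\<close>)
qed

text \<open>The value determines the shape of a reduced term except for the order and bracketing of sums. For
a sum, the other term is rearranged to match the two sides.\<close>

lemma reduced_unique:
  assumes "reduced s" "reduced t" "val s = val t"
  shows "s \<approx> t"
  using assms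
proof (induction s arbitrary: t)
  case (Atom x)
  then show ?case using reduced_val_Pre[of t x "{|Unit|}"] reduced_val_Unit by auto
next
  case One
  then show ?case using reduced_val_Unit[of t] by auto
next
  case (Mul r s)
  then obtain x where x: "r = Atom x" "val (r \<^bold>\<times> s) = {|Pre x (val s)|}"
    using val_reduced_mul by blast
  moreover have "val s \<noteq> {|Unit|}" using Mul.prems(1) reduced_val_Unit by auto
  ultimately obtain u where "t = Atom x \<^bold>\<times> u" "reduced u" "val u = val s"
    using reduced_val_Pre[of t x "val s"] Mul.prems by auto
  then show ?case using Mul.IH(2)[of u] Mul.prems(1) x(1) by (auto intro: ACp_mul)
next
  case (Add s1 s2)
  then obtain a b where "reduced a" "reduced b" "val a = val s1" "val b = val s2" "t \<approx> a \<^bold>+ b"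
    using reduced_split[of t "val s1" "val s2"] val_reduced_nonempty[of s1] val_reduced_nonempty[of s2]
    by auto
  moreover have "s1 \<approx> a" "s2 \<approx> b" using Add calculation by auto
  ultimately show ?case by (meson ACp_add ACp_sym ACp_trans)
qed simp


section \<open>Every term reduces\<close>

text \<open>Rearranging a sum preserves pairwise disjointness of the values of its parts, and inside a
product the left factor is an atom, which has only itself in its class.\<close>

lemma AC_plus_reduced:
  assumes "AC_plus X s t"
  shows "reduced s \<longleftrightarrow> reduced t"
  using assms unfolding AC_plus_def
proof (induction rule: gen_congruence.induct)
  case (base s t)
  from base(3) show ?case by cases auto
next
  case (add s s' t t')
  then show ?case by (auto dest!: val_AC_plus[unfolded AC_plus_def])
next
  case (mul s s' t t')
  then show ?case
    using AC_plus_leaf[of X s s'] AC_plus_leaf[of X t t'] by (auto simp: AC_plus_def)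
qed auto

text \<open>A single step absorbs \<open>AC\<^sub>+\<close>, but the empty reduction does not: then \<open>s\<close> is itself reduced, being
equal to a reduced term modulo \<open>AC\<^sub>+\<close>.\<close>

lemma reduces_to_reduced_modulo_ACp:
  assumes "s \<approx> s'" "s' \<leadsto> u" "reduced u"
  shows "\<exists>u. reduced u \<and> s \<leadsto> u"
  using assms(2)
proof (cases rule: converse_rtranclpE)
  case base
  then show ?thesis using assms AC_plus_reduced by blast
next
  case (step v)
  then have "R_id_mod_AC_plus UNIV s v"
    using assms(1) ACp_trans unfolding R_id_mod_AC_plus_def by blast
  then show ?thesis using step(2) assms(3) by (meson converse_rtranclp_into_rtranclp)
qed

text \<open>The summands of \<open>s\<close> are inserted one after the other. If the value of a summand already occurs in
\<open>t\<close>, then \<open>t\<close> can be rearranged to expose a copy of it, which idempotency removes.\<close>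

lemma reduces_add_reduced:
  assumes "reduced s" "reduced t"
  shows "\<exists>u. reduced u \<and> s \<^bold>+ t \<leadsto> u"
  using assms
proof (induction s arbitrary: t rule: reduced_sum_induct)
  case (summand s i)
  show ?case
  proof (cases "i |\<in>| val t")
    case False
    then show ?thesis using summand by (intro exI[of _ "s \<^bold>+ t"]) auto
  next
    case i: True
    show ?thesis
    proof (cases "val t = {|i|}")
      case True
      then have "s \<approx> t" using reduced_unique summand by metis
      then have "s \<^bold>+ t \<leadsto> t"
        by (intro reduces_R_id_modulo_ACp[of _ "t \<^bold>+ t"]) (auto intro: ACp_add R_id.intros)
      then show ?thesis using summand by blast
    next
      case False
      let ?B = "val t |-| {|i|}"
      have "?B \<noteq> {||}" using False i by auto
      then obtain a b where ab: "reduced a" "reduced b" "val a = {|i|}" "val b = ?B" "t \<approx> a \<^bold>+ b"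
        using reduced_split[of t "{|i|}" ?B] summand.prems i by auto
      then have "s \<approx> a" using reduced_unique summand by metis
      then have "a \<^bold>+ b \<approx> s \<^bold>+ b" by (intro ACp_add ACp_refl ACp_sym[of s])
      then have "t \<approx> s \<^bold>+ b" using ab(5) by (rule ACp_trans[rotated])
      then have "s \<^bold>+ t \<approx> s \<^bold>+ (s \<^bold>+ b)" by (intro ACp_add ACp_refl)
      then have "s \<^bold>+ t \<approx> (s \<^bold>+ s) \<^bold>+ b" using ACp_assoc ACp_trans by blast
      then have "R_id_mod_AC_plus UNIV (s \<^bold>+ t) (s \<^bold>+ b)" unfolding R_id_mod_AC_plus_def
        by (meson ACp_refl R_id.intros(9) rewrite_step.intros)
      moreover have "reduced (s \<^bold>+ b)" using ab summand by auto
      ultimately show ?thesis by blast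
    qed
  qed
next
  case (add s1 s2)
  obtain u where u: "reduced u" "s2 \<^bold>+ t \<leadsto> u" using add by blast
  obtain u' where u': "reduced u'" "s1 \<^bold>+ u \<leadsto> u'" using add u by blast
  have "s1 \<^bold>+ (s2 \<^bold>+ t) \<leadsto> u'"
    using reduces_add[OF rtranclp.rtrancl_refl u(2), of s1] u'(2) by (meson rtranclp_trans)
  then show ?case
    by (rule reduces_to_reduced_modulo_ACp[OF ACp_sym[OF ACp_assoc] _ u'(1)])
qed

text \<open>Right distributivity and associativity push \<open>t\<close> down to the rightmost positions of \<open>s\<close>; each
sum met on the way is merged again, which spares a proof that the products of different
summands with \<open>t\<close> stay different.\<close>

lemma reduces_mul_reduced:
  assumes "reduced s" "reduced t"
  shows "\<exists>u. reduced u \<and> s \<^bold>\<times> t \<leadsto> u"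
proof (cases "t = \<^bold>1")
  case True
  then show ?thesis using assms by (auto intro: reduces_R_id R_id.intros)
next
  case t: False
  show ?thesis using assms(1)
  proof (induction s)
    case (Atom x)
    then show ?case using assms t by (intro exI[of _ "Atom x \<^bold>\<times> t"]) auto
  next
    case One
    then show ?case using assms by (auto intro: reduces_R_id R_id.intros)
  next
    case (Add s1 s2)
    then obtain u1 u2 where u: "reduced u1" "s1 \<^bold>\<times> t \<leadsto> u1" "reduced u2" "s2 \<^bold>\<times> t \<leadsto> u2" by auto
    obtain u where "reduced u" "u1 \<^bold>+ u2 \<leadsto> u" using reduces_add_reduced u by blast
    moreover have "(s1 \<^bold>+ s2) \<^bold>\<times> t \<leadsto> s1 \<^bold>\<times> t \<^bold>+ s2 \<^bold>\<times> t" by (intro reduces_R_id R_id.intros)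
    moreover have "s1 \<^bold>\<times> t \<^bold>+ s2 \<^bold>\<times> t \<leadsto> u1 \<^bold>+ u2" using reduces_add u by blast
    ultimately show ?case by (meson rtranclp_trans)
  next
    case (Mul r s)
    then obtain x where x: "r = Atom x" by auto
    obtain u where u: "reduced u" "s \<^bold>\<times> t \<leadsto> u" using Mul by auto
    have "r \<^bold>\<times> s \<^bold>\<times> t \<leadsto> r \<^bold>\<times> (s \<^bold>\<times> t)" by (intro reduces_R_id R_id.intros)
    also have "\<dots> \<leadsto> r \<^bold>\<times> u" using u by (intro reduces_mul) auto
    finally have *: "r \<^bold>\<times> s \<^bold>\<times> t \<leadsto> r \<^bold>\<times> u" .
    show ?case
    proof (cases "u = \<^bold>1")
      case True
      then have "r \<^bold>\<times> u \<leadsto> r" by (auto intro: reduces_R_id R_id.intros)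
      with * have "r \<^bold>\<times> s \<^bold>\<times> t \<leadsto> r" by (meson rtranclp_trans)
      then show ?thesis using x by (intro exI[of _ r]) auto
    next
      case False
      then show ?thesis using x u * by (intro exI[of _ "r \<^bold>\<times> u"]) auto
    qed
  qed simp
qed

lemma reduces_to_reduced: "\<exists>u. (u = \<^bold>0 \<or> reduced u) \<and> t \<leadsto> u"
proof (induction t)
  case (Add s t)
  then obtain u v where u: "u = \<^bold>0 \<or> reduced u" "v = \<^bold>0 \<or> reduced v" "s \<^bold>+ t \<leadsto> u \<^bold>+ v"
    using reduces_add by blast
  have "\<exists>w. (w = \<^bold>0 \<or> reduced w) \<and> u \<^bold>+ v \<leadsto> w"
    using u(1,2) reduces_add_reduced reduces_R_id R_id.intros(1,2) by metis
  then obtain w where "w = \<^bold>0 \<or> reduced w" "u \<^bold>+ v \<leadsto> w" by blast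
  then show ?case using u(3) rtranclp_trans[of _ _ "u \<^bold>+ v" w] by blast
next
  case (Mul s t)
  then obtain u v where u: "u = \<^bold>0 \<or> reduced u" "v = \<^bold>0 \<or> reduced v" "s \<^bold>\<times> t \<leadsto> u \<^bold>\<times> v"
    using reduces_mul by blast
  have "\<exists>w. (w = \<^bold>0 \<or> reduced w) \<and> u \<^bold>\<times> v \<leadsto> w"
    using u(1,2) reduces_mul_reduced reduces_R_id R_id.intros(5,6) by metis
  then obtain w where "w = \<^bold>0 \<or> reduced w" "u \<^bold>\<times> v \<leadsto> w" by blast
  then show ?case using u(3) rtranclp_trans[of _ _ "u \<^bold>\<times> v" w] by blast
qed (auto intro: exI[of _ "Atom _"] exI[of _ "\<^bold>1"])


section \<open>Reduced terms are the normal forms\<close>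

text \<open>Every left-hand side violates one clause of \<open>reduced\<close>. For \<open>z + z\<close> the disjointness condition would
make the value of \<open>z\<close> empty.\<close>

lemma reduced_no_step:
  "rewrite_step R_id s t \<Longrightarrow> \<not> reduced s \<and> s \<noteq> \<^bold>0"
proof (induction rule: rewrite_step.induct)
  case (root s t)
  then show ?case by cases (auto dest: val_reduced_nonempty)
qed auto

lemma normal_form_reduced:
  assumes "t = \<^bold>0 \<or> reduced t"
  shows "normal_form (R_id_mod_AC_plus X) t"
  using assms AC_plus_reduced[of X t] AC_plus_leaf[of X t] reduced_no_step
  unfolding normal_form_def R_id_mod_AC_plus_def by metis

text \<open>A normal form admits only the empty reduction, so it coincides with the \<open>0\<close> or reduced term to
which it reduces.\<close>

lemma normal_form_imp_reduced:
  assumes "normal_form (R_id_mod_AC_plus X) t" "t \<in> terms X"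
  shows "t = \<^bold>0 \<or> reduced t"
proof -
  obtain u where "u = \<^bold>0 \<or> reduced u" "t \<leadsto> u" using reduces_to_reduced by blast
  then have "(R_id_mod_AC_plus X)\<^sup>*\<^sup>* t u" using reduces_restrict assms(2) by blast
  then have "t = u" using assms(1) by (cases rule: converse_rtranclpE) (auto simp: normal_form_def)
  with \<open>u = \<^bold>0 \<or> reduced u\<close> show ?thesis by simp
qed


section \<open>Reduced terms are id-reduced polynomial terms\<close>

lemma reduced_PT: "reduced t \<Longrightarrow> t \<in> terms X \<Longrightarrow> t \<in> PT X"
proof (induction t)
  case (Add s t)
  then show ?case by (auto intro!: PT.add)
next
  case (Mul s t)
  then show ?case by (auto intro!: PT.mul monomials.intros)
qed (auto intro: PT.intros monomials.intros)

fun summands :: "'x trm \<Rightarrow> 'x trm list" where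
  "summands (s \<^bold>+ t) = summands s @ summands t"
| "summands t = [t]"

lemma bracketed_summands: "bracketed_sum (summands t) t"
  by (induction t) (auto intro: bracketed_sum.intros)

lemma summands_reduced:
  "reduced t \<Longrightarrow> u \<in> set (summands t) \<Longrightarrow> reduced u \<and> val u |\<subseteq>| val t"
  by (induction t) auto

text \<open>Summands from different sides of a sum have disjoint nonempty values, while equality modulo \<open>AC\<close>
would make these values equal.\<close>

lemma summands_not_AC:
  "reduced t \<Longrightarrow> sorted_wrt (\<lambda>u v. \<not> AC u v) (summands t)"
proof (induction t)
  case (Add s t)
  have "\<not> AC u v" if "u \<in> set (summands s)" "v \<in> set (summands t)" for u v
    using summands_reduced[OF _ that(1)] summands_reduced[OF _ that(2)] Add.prems
      val_AC[of u v] val_reduced_nonempty[of u] by auto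
  then show ?case using Add by (auto simp: sorted_wrt_append)
qed auto

lemma reduced_ST: "reduced t \<Longrightarrow> t \<in> terms X \<Longrightarrow> t \<in> ST X"
  using reduced_PT PT_subset_ST by blast

lemma summands_decomposition:
  assumes "reduced t" "t \<in> terms X"
  shows "set (summands t) \<subseteq> product_terms X \<union> Atom ` X \<union> {\<^bold>1}"
  using assms
proof (induction t)
  case (Mul s t)
  then have "s \<^bold>\<times> t \<in> ST X" using reduced_ST by blast
  then show ?case by (auto simp: ST_simps product_terms_def)
qed auto

lemma length_summands: "length (summands t) \<ge> 1"
  by (induction t) auto

text \<open>The claim about the summands is carried along because the rule for sums speaks about the whole
decomposition of the sum, not about its two sides.\<close>

lemma reduced_ST_id:
  assumes "reduced t" "t \<in> terms X"
  shows "t \<in> ST_id X \<and> (\<forall>u \<in> set (summands t). u \<in> ST_id X)"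
  using assms
proof (induction t)
  case (Add s t)
  have "s \<^bold>+ t \<in> ST X" using Add.prems reduced_ST by blast
  then have "s \<^bold>+ t \<in> sum_terms X" by (auto simp: ST_simps sum_terms_def)
  moreover have "sum_product_decomposition X (s \<^bold>+ t) (summands (s \<^bold>+ t))"
    unfolding sum_product_decomposition_def
    using bracketed_summands summands_decomposition[OF Add.prems]
      length_summands[of s] length_summands[of t] by fastforce
  moreover have "\<forall>u \<in> set (summands (s \<^bold>+ t)). u \<in> ST_id X" using Add by auto
  moreover have "\<forall>i j. i < j \<and> j < length (summands (s \<^bold>+ t))
      \<longrightarrow> \<not> AC (summands (s \<^bold>+ t) ! i) (summands (s \<^bold>+ t) ! j)"
    using summands_not_AC[OF Add.prems(1)] by (simp add: sorted_wrt_iff_nth_less)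
  ultimately show ?case using ST_id.sum by blast
next
  case (Mul s t)
  then show ?case by (auto intro!: ST_id.mul)
qed (auto intro: ST_id.intros monomials.intros)

lemma reduced_PT_id: "t = \<^bold>0 \<or> reduced t \<Longrightarrow> t \<in> terms X \<Longrightarrow> t \<in> PT_id X"
  unfolding PT_id_def using reduced_PT reduced_ST_id PT.zero ST_id.zero by blast


section \<open>Reduction respects the equational theory\<close>

lemma E_id_rd_AC_plus: "AC_plus X s t \<Longrightarrow> E_id_rd X s t"
  unfolding AC_plus_def E_id_rd_def
proof (induction rule: gen_congruence.induct)
  case (base s t)
  from base(3) have "E_id_rd_axiom s t" by cases (auto intro: E_id_rd_axiom.intros)
  with base show ?case by (auto intro: gen_congruence.base)
qed (auto intro: gen_congruence.intros)

lemma E_id_rd_R_id: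
  assumes "rewrite_step R_id s t" "s \<in> terms X"
  shows "E_id_rd X s t"
  using assms
proof (induction rule: rewrite_step.induct)
  case (root s t)
  have ax: "E_id_rd X a b" if "E_id_rd_axiom a b" "a \<in> terms X" "b \<in> terms X" for a b
    using that unfolding E_id_rd_def by (intro gen_congruence.base)
  \<comment> \<open>Two rules are not axioms read from left to right: \<open>0 + z\<close> needs commutativity first, and
    associativity of the product is oriented the other way.\<close>
  note sym = gen_congruence.sym[of X E_id_rd_axiom, folded E_id_rd_def]
  note trans = gen_congruence.trans[of X E_id_rd_axiom, folded E_id_rd_def]
  from root(1) show ?case
  proof cases
    case 1
    have "E_id_rd X s (t \<^bold>+ \<^bold>0)" "E_id_rd X (t \<^bold>+ \<^bold>0) t"
      using 1 root(2) by (auto intro!: ax E_id_rd_axiom.intros)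
    then show ?thesis by (rule trans)
  next
    case (7 z1 z2 z3)
    have "E_id_rd X t s"
      using 7 root(2) by (auto intro!: ax E_id_rd_axiom.intros)
    then show ?thesis by (rule sym)
  qed (use root(2) in \<open>auto intro!: ax E_id_rd_axiom.intros\<close>)
qed (auto simp: E_id_rd_def intro: gen_congruence.intros)

lemma E_id_rd_reduces:
  assumes "(R_id_mod_AC_plus X)\<^sup>*\<^sup>* s t" "s \<in> terms X"
  shows "E_id_rd X s t"
  using assms(1)
proof induction
  case base
  then show ?case using assms(2) by (auto simp: E_id_rd_def intro: gen_congruence.refl)
next
  case (step t u)
  from step(2) obtain t' u' where *: "AC_plus X t t'" "rewrite_step R_id t' u'" "AC_plus X u' u"
    by (auto simp: R_id_mod_AC_plus_def)
  then have "t' \<in> terms X" using gen_congruence_terms unfolding AC_plus_def by blast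
  then have "E_id_rd X t t'" "E_id_rd X t' u'" "E_id_rd X u' u"
    using * E_id_rd_AC_plus E_id_rd_R_id by blast+
  then show ?case using step.IH unfolding E_id_rd_def by (meson gen_congruence.trans)
qed

section \<open>Existence and uniqueness of the normal form\<close>

theorem theorem6p17:
  fixes X :: "'x set" and t :: "'x trm"
  assumes "X \<noteq> {}" and "t \<in> terms X"
  shows "\<exists>t'. (t' \<in> PT_id X \<and> normal_form (R_id_mod_AC_plus X) t' \<and> (R_id_mod_AC_plus X)\<^sup>*\<^sup>* t t')
           \<and> E_id_rd X t t'
           \<and> (\<forall>t''. t'' \<in> PT_id X \<and> normal_form (R_id_mod_AC_plus X) t''
                    \<and> (R_id_mod_AC_plus X)\<^sup>*\<^sup>* t t'' \<longrightarrow> AC_plus X t'' t')"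
proof -
  obtain t' where t': "t' = \<^bold>0 \<or> reduced t'" "t \<leadsto> t'"
    using reduces_to_reduced by blast
  then have red: "(R_id_mod_AC_plus X)\<^sup>*\<^sup>* t t'" "t' \<in> terms X"
    using reduces_restrict assms(2) by blast+
  have "AC_plus X t'' t'"
    if "t'' \<in> PT_id X" "normal_form (R_id_mod_AC_plus X) t''" "(R_id_mod_AC_plus X)\<^sup>*\<^sup>* t t''" for t''
  proof -
    have "t'' \<in> terms X" using that(1) PT_subset_ST by (auto simp: PT_id_def ST_def)
    then have "t'' = \<^bold>0 \<or> reduced t''" using that(2) normal_form_imp_reduced by blast
    moreover have "val t'' = val t'"
      using val_R_id_mod_star[OF that(3)] val_R_id_mod_star[OF red(1)] by simp
    ultimately have "t'' \<approx> t'"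
      using t'(1) val_reduced_nonempty reduced_unique by (metis ACp_refl val.simps(2))
    then show ?thesis using AC_plus_UNIV_restrict \<open>t'' \<in> terms X\<close> by blast
  qed
  moreover have "t' \<in> PT_id X" using t'(1) red(2) by (rule reduced_PT_id)
  moreover have "normal_form (R_id_mod_AC_plus X) t'" using t'(1) by (rule normal_form_reduced)
  moreover have "E_id_rd X t t'" using red(1) assms(2) by (rule E_id_rd_reduces)
  ultimately show ?thesis using red(1) by (intro exI[of _ t']) simp
qed

end
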